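(* Let $G=(V,E)$ be a finite interval graph. Then for every weight function $w:V\to\mathbb{N}$ one has $\gamma_w(G)=\rho_w(G)$.
   Context: All graphs are finite and simple, and $\mathbb{N}=\{0,1,2,\dots\}$. A graph is an interval graph if it is the intersection graph (line graph) of a finite family of (nonempty) intervals of the line, that is, its vertices are the intervals of the family, and two distinct vertices are adjacent if and only if the corresponding intervals intersect. For a vertex $v$ of $G=(V,E)$, $N(v)$ denotes the closed neighborhood of $v$, i.e. $v$ together with all vertices adjacent to $v$. For a real valued function $f$ on $V$ and $A\subseteq V$, write $f[A]=\sum_{a\in A}f(a)$, and $|f|=f[V]$ is called the size of $f$. Given $w:V\to\mathbb{N}$, a nonnegative function $f$ on $V$ is $w$-dominating if $f[N(u)]\ge w(u)$ for every $u\in V$. The weighted domination number $\gamma_w(G)$ is the minimal size $|f|$ of an integer valued nonnegative $w$-dominating function $f:V\to\mathbb{N}$. A set of vertices of $G$ is dispersed if every two distinct elements of it are at distance at least $3$ in $G$ (vertices in different connected components are at infinite distance). $\rho_w(G)$ is the maximum of $w[I]$ over all dispersed sets $I\subseteq V$. *)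

theory Defs
  imports "HOL-Analysis.Analysis" "Graph_Theory.Graph_Theory"
begin

text \<open>
  Finite simple graphs are the \<^locale>\<open>pair_graph\<close>s of the entry Graph_Theory: finite digraphs
  without parallel arcs whose arc relation is irreflexive and symmetric, so that an edge
  between \<open>u\<close> and \<open>v\<close> is the pair of arcs \<open>(u, v)\<close> and \<open>(v, u)\<close>.

  Functions on the vertex set are total functions on the vertex type; only their
  values on \<open>pverts G\<close> matter.
\<close>

text \<open>
  The family of intervals is indexed by the vertices, so equal intervals may represent
  distinct (then adjacent) vertices. Intervals may be open, half-open, closed, degenerate
  or unbounded.
\<close>

definition interval_graph :: "'a pair_pre_digraph \<Rightarrow> bool" where
  "interval_graph G \<longleftrightarrow>
    (\<exists>I :: 'a \<Rightarrow> real set.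
      (\<forall>v\<in>pverts G. is_interval (I v) \<and> I v \<noteq> {}) \<and>
      (\<forall>u\<in>pverts G. \<forall>v\<in>pverts G. u \<noteq> v \<longrightarrow> ((u, v) \<in> parcs G \<longleftrightarrow> I u \<inter> I v \<noteq> {})))"

definition closed_nbhd :: "'a pair_pre_digraph \<Rightarrow> 'a \<Rightarrow> 'a set" where
  "closed_nbhd G v = insert v {u \<in> pverts G. (v, u) \<in> parcs G}"

definition w_dominating :: "'a pair_pre_digraph \<Rightarrow> ('a \<Rightarrow> nat) \<Rightarrow> ('a \<Rightarrow> real) \<Rightarrow> bool" where
  "w_dominating G w f \<longleftrightarrow>
    (\<forall>v\<in>pverts G. 0 \<le> f v) \<and>
    (\<forall>u\<in>pverts G. real (w u) \<le> (\<Sum>v\<in>closed_nbhd G u. f v))"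

definition weighted_domination_number :: "'a pair_pre_digraph \<Rightarrow> ('a \<Rightarrow> nat) \<Rightarrow> nat" where
  "weighted_domination_number G w =
    (LEAST n. \<exists>f :: 'a \<Rightarrow> nat. w_dominating G w (\<lambda>v. real (f v)) \<and> n = (\<Sum>v\<in>pverts G. f v))"

text \<open>
  With unit arc costs, \<open>\<mu>\<close> is the usual graph distance, with value \<open>\<infinity>\<close>
  between different connected components.
\<close>

definition graph_dist :: "'a pair_pre_digraph \<Rightarrow> 'a \<Rightarrow> 'a \<Rightarrow> ereal" where
  "graph_dist G u v = wf_digraph.\<mu> (with_proj G) (\<lambda>_. 1) u v"

definition dispersed :: "'a pair_pre_digraph \<Rightarrow> 'a set \<Rightarrow> bool" where
  "dispersed G I \<longleftrightarrow>
    I \<subseteq> pverts G \<and> (\<forall>u\<in>I. \<forall>v\<in>I. u \<noteq> v \<longrightarrow> 3 \<le> graph_dist G u v)"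

definition max_dispersed_weight :: "'a pair_pre_digraph \<Rightarrow> ('a \<Rightarrow> nat) \<Rightarrow> nat" where
  "max_dispersed_weight G w = Max {\<Sum>v\<in>I. w v | I. dispersed G I}"

text \<open>
  For a finite graph the minimum and the maximum above exist: \<open>w\<close> itself is
  \<open>w\<close>-dominating, and the empty set is dispersed.
\<close>

lemma (in pair_graph) finite_closed_nbhd: "finite (closed_nbhd G v)"
  using pair_finite_verts by (simp add: closed_nbhd_def)

lemma (in pair_graph) w_dominating_self: "w_dominating G w (\<lambda>v. real (w v))"
proof -
  have "real (w u) \<le> (\<Sum>v\<in>closed_nbhd G u. real (w v))" for u
    by (rule member_le_sum) (auto simp: finite_closed_nbhd, simp add: closed_nbhd_def)
  then show ?thesis by (simp add: w_dominating_def)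
qed

lemma (in pair_graph) weighted_domination_number_attained:
  "\<exists>f :: 'a \<Rightarrow> nat. w_dominating G w (\<lambda>v. real (f v)) \<and>
     weighted_domination_number G w = (\<Sum>v\<in>pverts G. f v)"
  unfolding weighted_domination_number_def
  by (rule LeastI_ex) (use w_dominating_self in blast)

lemma (in pair_graph) max_dispersed_weight_attained:
  "\<exists>I. dispersed G I \<and> max_dispersed_weight G w = (\<Sum>v\<in>I. w v)"
  and max_dispersed_weight_upper:
  "dispersed G J \<Longrightarrow> (\<Sum>v\<in>J. w v) \<le> max_dispersed_weight G w"
proof -
  let ?S = "{\<Sum>v\<in>I. w v | I. dispersed G I}"
  have "?S \<subseteq> sum w ` Pow (pverts G)" by (auto simp: dispersed_def)
  then have fin: "finite ?S"
    using pair_finite_verts finite_subset by blast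
  have "dispersed G {}" by (simp add: dispersed_def)
  then have "?S \<noteq> {}" by blast
  then have "Max ?S \<in> ?S" using fin by (rule Max_in[rotated])
  then show "\<exists>I. dispersed G I \<and> max_dispersed_weight G w = (\<Sum>v\<in>I. w v)"
    unfolding max_dispersed_weight_def by blast
  show "dispersed G J \<Longrightarrow> (\<Sum>v\<in>J. w v) \<le> max_dispersed_weight G w"
    unfolding max_dispersed_weight_def by (rule Max_ge[OF fin]) blast
qed

end

theory Submission
  imports Defs
begin

text \<open>
  Two distinct vertices are at distance at least 3 iff their closed neighborhoods are disjoint.
  So \<open>\<rho>\<^sub>w\<close> asks for disjoint closed neighborhoods of maximal total weight, while \<open>\<gamma>\<^sub>w\<close> asks for
  a cheapest function giving each closed neighborhood its weight. The inequality
  \<open>\<rho>\<^sub>w \<le> \<gamma>\<^sub>w\<close> holds in every graph (\<open>dispersed_weight_le\<close>).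

  Equality follows by induction on the number of vertices of positive weight. Among these let
  \<open>u\<close> be one whose interval ends first, and among \<open>u\<close> and its neighbors let \<open>m\<close> be one whose
  interval reaches furthest to the right. If \<open>v\<close> is another vertex of positive weight and some
  interval \<open>x\<close> meets those of \<open>u\<close> and \<open>v\<close>, then \<open>m\<close> already meets \<open>v\<close>: it starts no later than
  the end of \<open>u\<close>, hence of \<open>v\<close>, and it reaches at least as far as \<open>x\<close>, so past the start of \<open>v\<close>
  (\<open>interval_meets_later\<close>, \<open>interval_pivot\<close>). Lower by \<open>w u\<close> (truncated at 0) the weight of all
  vertices in the closed neighborhood of \<open>m\<close>, and take, by induction, a dominating function \<open>f\<close>
  and a dispersed set \<open>I\<close> of equal value for the new weights, where \<open>I\<close> has only vertices of
  positive new weight. Adding \<open>w u\<close> to \<open>f m\<close> makes \<open>f\<close> dominating for \<open>w\<close>. At most one vertex of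
  \<open>I\<close> lies in the closed neighborhood of \<open>m\<close>. If there is one, the original weight of \<open>I\<close> is
  larger by exactly \<open>w u\<close>; if there is none, the choice of \<open>m\<close> makes \<open>I\<close> together with \<open>u\<close>
  dispersed, which again adds \<open>w u\<close>.
  This is lemma \<open>pivot_imp_packing_cover\<close>.
\<close>


section \<open>Packing and covering with pivots\<close>

text \<open>
  A statement on arbitrary finite families of finite sets \<open>N v\<close>. The assumption \<open>pivot\<close> says that
  every nonempty subfamily has a member \<open>N u\<close> with an element \<open>m\<close> that lies in every member
  meeting \<open>N u\<close>. The conclusion is a packing and an integral covering of equal value, for any
  weights.
\<close>

lemma pivot_imp_packing_cover:
  fixes N :: "'a \<Rightarrow> 'b set" and w :: "'a \<Rightarrow> nat"
  assumes finV: "finite V" and finX: "finite X"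
    and sub: "\<And>v. v \<in> V \<Longrightarrow> N v \<subseteq> X"
    and pivot: "\<And>S. S \<subseteq> V \<Longrightarrow> S \<noteq> {} \<Longrightarrow>
      \<exists>u\<in>S. \<exists>m\<in>N u. \<forall>v\<in>S. N u \<inter> N v \<noteq> {} \<longrightarrow> m \<in> N v"
  shows "\<exists>(f :: 'b \<Rightarrow> nat) I. (\<forall>v\<in>V. w v \<le> sum f (N v)) \<and> I \<subseteq> V \<and>
    disjoint_family_on N I \<and> sum f X = sum w I"
proof (induction "card {v\<in>V. 0 < w v}" arbitrary: w rule: less_induct)
  case less
  let ?S = "{v\<in>V. 0 < w v}"
  show ?case
  proof (cases "?S = {}")
    case True
    then have "(\<forall>v\<in>V. w v \<le> sum (\<lambda>_. 0) (N v)) \<and> {} \<subseteq> V \<and>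
        disjoint_family_on N {} \<and> sum (\<lambda>_. 0) X = sum w {}"
      by (auto simp: disjoint_family_on_def)
    then show ?thesis by blast
  next
    case False
    then obtain u m where u: "u \<in> ?S" and m: "m \<in> N u"
      and um: "\<And>v. v \<in> ?S \<Longrightarrow> N u \<inter> N v \<noteq> {} \<Longrightarrow> m \<in> N v"
      using pivot[of ?S] by blast
    define w' where "w' v = (if m \<in> N v then w v - w u else w v)" for v
    have w'_le: "w' v \<le> w v" for v
      by (simp add: w'_def)
    have "{v\<in>V. 0 < w' v} \<subset> ?S"
    proof
      show "{v\<in>V. 0 < w' v} \<subseteq> ?S"
        using w'_le by (auto intro: less_le_trans)
      have "w' u = 0"
        using m by (simp add: w'_def)
      then have "u \<notin> {v\<in>V. 0 < w' v}"
        by simp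
      then show "{v\<in>V. 0 < w' v} \<noteq> ?S"
        using u by blast
    qed
    then have "card {v\<in>V. 0 < w' v} < card ?S"
      using finV by (simp add: psubset_card_mono)
    from less[OF this] obtain f J where f: "\<And>v. v \<in> V \<Longrightarrow> w' v \<le> sum f (N v)"
      and J: "J \<subseteq> V" "disjoint_family_on N J" and fJ: "sum f X = sum w' J"
      by blast
    \<comment> \<open>Members of zero new weight are dropped: \<open>um\<close> and exact subtraction need positive weight.\<close>
    define I where "I = {v\<in>J. 0 < w' v}"
    have I: "I \<subseteq> ?S" "disjoint_family_on N I"
      using J w'_le by (auto simp: I_def disjoint_family_on_def intro: less_le_trans)
    have finI: "finite I"
      using I(1) finV by (auto intro: finite_subset)
    have fI: "sum f X = sum w' I"
      unfolding fJ I_def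
      by (rule sum.mono_neutral_right) (use J(1) finV in \<open>auto intro: finite_subset\<close>)
    define g where "g x = f x + (if x = m then w u else 0)" for x
    have g_sum: "sum g A = sum f A + (if m \<in> A then w u else 0)" if "finite A" for A
      using that by (simp add: g_def sum.distrib)
    have cover: "w v \<le> sum g (N v)" if "v \<in> V" for v
    proof -
      have "finite (N v)"
        using sub[OF that] finX by (rule finite_subset)
      then show ?thesis
        using f[OF that] by (auto simp: g_sum w'_def split: if_splits)
    qed
    have g_size: "sum g X = sum w' I + w u"
      using m sub[of u] u finX by (auto simp: g_sum fI)
    show ?thesis
    proof (cases "\<exists>v\<in>I. m \<in> N v")
      case True
      then obtain v where v: "v \<in> I" "m \<in> N v" by blast
      have "w x = w' x" if "x \<in> I - {v}" for x
        using that v I(2) by (auto simp: disjoint_family_on_def w'_def)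
      then have "sum w (I - {v}) = sum w' (I - {v})"
        by (rule sum.cong[OF refl])
      \<comment> \<open>The truncated subtraction is exact at \<open>v\<close> because \<open>w' v\<close> is positive.\<close>
      moreover have "w v = w' v + w u"
        using v by (auto simp: I_def w'_def)
      ultimately have "sum w I = sum w' I + w u"
        using sum.remove[OF finI v(1), of w] sum.remove[OF finI v(1), of w'] by simp
      then show ?thesis
        using cover g_size I by (intro exI[of _ g] exI[of _ I]) auto
    next
      case False
      then have "u \<notin> I" and "sum w I = sum w' I"
        using m by (auto simp: w'_def intro: sum.cong)
      then have "sum w (insert u I) = sum w' I + w u"
        using finI by simp
      moreover have "disjoint_family_on N (insert u I)"
        using False I um unfolding disjoint_family_on_def by blast
      ultimately show ?thesis
        using cover g_size I(1) u by (intro exI[of _ g] exI[of _ "insert u I"]) auto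
    qed
  qed
qed


section \<open>Intervals ordered by their right ends\<close>

text \<open>
  The set of points not to the right of all of \<open>A\<close>. Inclusion of these sets compares right ends of
  intervals, distinguishing an attained right end from one that is not attained, and makes sense
  also for unbounded intervals.
\<close>

definition down_closure :: "real set \<Rightarrow> real set" where
  "down_closure A = {x. \<exists>y\<in>A. x \<le> y}"

lemma down_closure_linear: "down_closure A \<subseteq> down_closure B \<or> down_closure B \<subseteq> down_closure A"
proof (rule disjCI)
  assume "\<not> down_closure B \<subseteq> down_closure A"
  then obtain b x where "b \<in> B" "x \<le> b" "\<And>a. a \<in> A \<Longrightarrow> a < x"
    unfolding down_closure_def by (auto simp: subset_iff not_le)
  then show "down_closure A \<subseteq> down_closure B"
    unfolding down_closure_def by (smt (verit) mem_Collect_eq subsetI)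
qed

lemma down_closureD:
  assumes "down_closure A \<subseteq> down_closure B" and "x \<in> A"
  shows "\<exists>y\<in>B. x \<le> y"
  using assms unfolding down_closure_def by blast

lemma exists_first_end:
  fixes I :: "'a \<Rightarrow> real set"
  assumes "finite S" and "S \<noteq> {}"
  shows "\<exists>u\<in>S. \<forall>v\<in>S. down_closure (I u) \<subseteq> down_closure (I v)"
proof -
  obtain u where "u \<in> S"
    "\<And>v. v \<in> S \<Longrightarrow> down_closure (I v) \<subseteq> down_closure (I u) \<Longrightarrow> down_closure (I u) = down_closure (I v)"
    using finite_has_minimal[of "(\<lambda>v. down_closure (I v)) ` S"] assms by auto
  then show ?thesis using down_closure_linear by blast
qed

lemma exists_last_end:
  fixes I :: "'a \<Rightarrow> real set"
  assumes "finite S" and "S \<noteq> {}"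
  shows "\<exists>u\<in>S. \<forall>v\<in>S. down_closure (I v) \<subseteq> down_closure (I u)"
proof -
  obtain u where "u \<in> S"
    "\<And>v. v \<in> S \<Longrightarrow> down_closure (I u) \<subseteq> down_closure (I v) \<Longrightarrow> down_closure (I u) = down_closure (I v)"
    using finite_has_maximal[of "(\<lambda>v. down_closure (I v)) ` S"] assms by auto
  then show ?thesis using down_closure_linear by blast
qed

text \<open>
  If \<open>B\<close> ends no earlier than \<open>A\<close>, and \<open>M\<close> meets \<open>A\<close> and reaches at least as far right as some
  \<open>X\<close> meeting \<open>B\<close>, then \<open>M\<close> itself meets \<open>B\<close>.
\<close>

lemma interval_meets_later:
  assumes M: "is_interval M" and B: "is_interval B"
    and AB: "down_closure A \<subseteq> down_closure B" and XM: "down_closure X \<subseteq> down_closure M"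
    and MA: "M \<inter> A \<noteq> {}" and XB: "X \<inter> B \<noteq> {}"
  shows "M \<inter> B \<noteq> {}"
proof -
  obtain s where s: "s \<in> M" "s \<in> A" using MA by blast
  obtain q where q: "q \<in> X" "q \<in> B" using XB by blast
  obtain t where t: "t \<in> B" "s \<le> t" using down_closureD[OF AB s(2)] by blast
  obtain r where r: "r \<in> M" "q \<le> r" using down_closureD[OF XM q(1)] by blast
  show ?thesis
  proof (cases "s \<le> q")
    case True
    then have "q \<in> M"
      using M s(1) r unfolding is_interval_1 by blast
    then show ?thesis using q by blast
  next
    case False
    then have "s \<in> B"
      using B q(2) t unfolding is_interval_1 by (meson linear)
    then show ?thesis using s by blast
  qed
qed

lemma interval_pivot:
  fixes I :: "'a \<Rightarrow> real set"
  assumes fin: "finite V" and SV: "S \<subseteq> V" and ne: "S \<noteq> {}"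
    and int: "\<And>v. v \<in> V \<Longrightarrow> is_interval (I v) \<and> I v \<noteq> {}"
    and N: "\<And>v. v \<in> V \<Longrightarrow> N v = {x\<in>V. I x \<inter> I v \<noteq> {}}"
  shows "\<exists>u\<in>S. \<exists>m\<in>N u. \<forall>v\<in>S. N u \<inter> N v \<noteq> {} \<longrightarrow> m \<in> N v"
proof -
  obtain u where u: "u \<in> S" "\<And>v. v \<in> S \<Longrightarrow> down_closure (I u) \<subseteq> down_closure (I v)"
    using exists_first_end[of S I] finite_subset[OF SV fin] ne by blast
  have "u \<in> V" using u(1) SV by blast
  then have "u \<in> N u" and "finite (N u)"
    using N int fin by auto
  then obtain m where m: "m \<in> N u" "\<And>x. x \<in> N u \<Longrightarrow> down_closure (I x) \<subseteq> down_closure (I m)"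
    using exists_last_end[of "N u" I] by blast
  have "m \<in> N v" if v: "v \<in> S" and meet: "N u \<inter> N v \<noteq> {}" for v
  proof -
    obtain x where x: "x \<in> N u" "x \<in> N v" using meet by blast
    have "v \<in> V" using v SV by blast
    have "I m \<inter> I v \<noteq> {}"
      by (rule interval_meets_later[of _ _ "I u" "I x"])
        (use int N \<open>u \<in> V\<close> \<open>v \<in> V\<close> m x u(2)[OF v] in auto)
    then show ?thesis using N \<open>u \<in> V\<close> \<open>v \<in> V\<close> m(1) by simp
  qed
  then show ?thesis using u(1) m(1) by blast
qed

lemma interval_graph_nbhd:
  assumes "interval_graph G"
  shows "\<exists>I :: 'a \<Rightarrow> real set. (\<forall>v\<in>pverts G. is_interval (I v) \<and> I v \<noteq> {}) \<and>
    (\<forall>v\<in>pverts G. closed_nbhd G v = {x\<in>pverts G. I x \<inter> I v \<noteq> {}})"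
proof -
  obtain I :: "'a \<Rightarrow> real set" where I: "\<forall>v\<in>pverts G. is_interval (I v) \<and> I v \<noteq> {}"
    and arc: "\<forall>u\<in>pverts G. \<forall>v\<in>pverts G. u \<noteq> v \<longrightarrow> ((u, v) \<in> parcs G \<longleftrightarrow> I u \<inter> I v \<noteq> {})"
    using assms unfolding interval_graph_def by (elim exE conjE)
  have "x \<in> closed_nbhd G v \<longleftrightarrow> x \<in> pverts G \<and> I x \<inter> I v \<noteq> {}" if v: "v \<in> pverts G" for v x
  proof (cases "x = v")
    case True
    then show ?thesis using v I by (simp add: closed_nbhd_def)
  next
    case False
    then have "x \<in> pverts G \<Longrightarrow> (v, x) \<in> parcs G \<longleftrightarrow> I x \<inter> I v \<noteq> {}"
      using arc v by (auto simp: Int_commute)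
    then show ?thesis using False by (auto simp: closed_nbhd_def)
  qed
  then have "\<forall>v\<in>pverts G. closed_nbhd G v = {x\<in>pverts G. I x \<inter> I v \<noteq> {}}"
    by auto
  with I show ?thesis by (intro exI conjI)
qed


section \<open>Dispersed sets and weak duality\<close>

context pair_graph
begin

lemma closed_nbhd_subset: "v \<in> pverts G \<Longrightarrow> closed_nbhd G v \<subseteq> pverts G"
  by (auto simp: closed_nbhd_def)

lemma awalk_cost_unit: "awalk_cost (\<lambda>_. 1) p = real (length p)"
  by (induction p) auto

lemma graph_dist_ge_iff:
  "ereal (real k) \<le> graph_dist G u v \<longleftrightarrow> (\<forall>p. awalk u p v \<longrightarrow> k \<le> length p)"
  unfolding graph_dist_def \<mu>_def by (auto simp: le_INF_iff awalk_cost_unit)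

lemma graph_dist_ge_3_iff:
  assumes "u \<in> pverts G" and "v \<in> pverts G" and "u \<noteq> v"
  shows "3 \<le> graph_dist G u v \<longleftrightarrow> closed_nbhd G u \<inter> closed_nbhd G v = {}"
proof -
  have sym: "(x, y) \<in> parcs G \<longleftrightarrow> (y, x) \<in> parcs G" for x y
    using pair_sym_arcs by (auto simp: symmetric_def dest: symD)
  have "3 \<le> graph_dist G u v \<longleftrightarrow> (\<forall>p. awalk u p v \<longrightarrow> 3 \<le> length p)"
    using graph_dist_ge_iff[of 3 u v] by simp
  also have "\<dots> \<longleftrightarrow> closed_nbhd G u \<inter> closed_nbhd G v = {}"
  proof
    assume long: "\<forall>p. awalk u p v \<longrightarrow> 3 \<le> length p"
    have no_arc: "(u, v) \<notin> parcs G"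
      using long[rule_format, of "[(u, v)]"] assms by (auto simp: awalk_simps)
    have no_path: "\<not> ((u, x) \<in> parcs G \<and> (x, v) \<in> parcs G)" for x
      using long[rule_format, of "[(u, x), (x, v)]"] assms by (auto simp: awalk_simps)
    show "closed_nbhd G u \<inter> closed_nbhd G v = {}"
      using no_arc no_path sym assms(3) by (auto simp: closed_nbhd_def)
  next
    assume disj: "closed_nbhd G u \<inter> closed_nbhd G v = {}"
    show "\<forall>p. awalk u p v \<longrightarrow> 3 \<le> length p"
    proof (intro allI impI, rule ccontr)
      fix p assume p: "awalk u p v" and "\<not> 3 \<le> length p"
      then consider "p = []" | e where "p = [e]" | e e' where "p = [e, e']"
        by (cases p rule: remdups_adj.cases) (auto simp: not_le less_Suc_eq numeral_3_eq_3)
      then show False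
      proof cases
        case 1
        then show False using p assms(3) by (simp add: awalk_simps)
      next
        case 2
        then have "(u, v) \<in> parcs G" using p by (cases e) (auto simp: awalk_simps)
        then show False using disj assms by (auto simp: closed_nbhd_def)
      next
        case 3
        then obtain x where x: "(u, x) \<in> parcs G" "(x, v) \<in> parcs G"
          using p by (cases e; cases e') (auto simp: awalk_simps)
        then have "x \<in> closed_nbhd G u \<inter> closed_nbhd G v"
          using sym in_arcsD2 by (auto simp: closed_nbhd_def)
        then show False using disj by blast
      qed
    qed
  qed
  finally show ?thesis .
qed

lemma dispersed_iff:
  "dispersed G I \<longleftrightarrow> I \<subseteq> pverts G \<and> disjoint_family_on (closed_nbhd G) I"
  unfolding dispersed_def disjoint_family_on_def using graph_dist_ge_3_iff by blast

lemma dispersed_weight_le: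
  fixes f :: "'a \<Rightarrow> nat"
  assumes I: "dispersed G I" and f: "w_dominating G w (\<lambda>v. real (f v))"
  shows "sum w I \<le> sum f (pverts G)"
proof -
  have IV: "I \<subseteq> pverts G" and disj: "disjoint_family_on (closed_nbhd G) I"
    using I by (auto simp: dispersed_iff)
  have finI: "finite I"
    using IV pair_finite_verts by (rule finite_subset)
  have "w v \<le> sum f (closed_nbhd G v)" if "v \<in> I" for v
  proof -
    have "real (w v) \<le> real (sum f (closed_nbhd G v))"
      using f that IV unfolding w_dominating_def by auto
    then show ?thesis by (simp only: of_nat_le_iff)
  qed
  then have "sum w I \<le> (\<Sum>v\<in>I. sum f (closed_nbhd G v))"
    by (rule sum_mono)
  also have "\<dots> = sum f (\<Union>v\<in>I. closed_nbhd G v)"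
    using finI disj finite_closed_nbhd
    by (intro sum.UNION_disjoint[symmetric]) (auto simp: disjoint_family_on_def)
  also have "\<dots> \<le> sum f (pverts G)"
    using IV closed_nbhd_subset pair_finite_verts by (intro sum_mono2) auto
  finally show ?thesis .
qed

end


section \<open>Equality for interval graphs\<close>

theorem theorem3p1:
  fixes G :: "'a pair_pre_digraph" and w :: "'a \<Rightarrow> nat"
  assumes "pair_graph G" and "interval_graph G"
  shows "weighted_domination_number G w = max_dispersed_weight G w"
proof (rule antisym)
  interpret pair_graph G by fact
  obtain R :: "'a \<Rightarrow> real set" where R: "\<forall>v\<in>pverts G. is_interval (R v) \<and> R v \<noteq> {}"
    "\<forall>v\<in>pverts G. closed_nbhd G v = {x\<in>pverts G. R x \<inter> R v \<noteq> {}}"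
    using interval_graph_nbhd[OF assms(2)] by (elim exE conjE)
  obtain f :: "'a \<Rightarrow> nat" and I where f: "\<And>v. v \<in> pverts G \<Longrightarrow> w v \<le> sum f (closed_nbhd G v)"
    and I: "I \<subseteq> pverts G" "disjoint_family_on (closed_nbhd G) I"
    and eq: "sum f (pverts G) = sum w I"
    using pivot_imp_packing_cover[OF pair_finite_verts pair_finite_verts closed_nbhd_subset
        interval_pivot[OF pair_finite_verts _ _ R[rule_format]], of w]
    by blast
  have "real (w v) \<le> (\<Sum>x\<in>closed_nbhd G v. real (f x))" if "v \<in> pverts G" for v
    using f[OF that] by (simp only: of_nat_sum[symmetric] of_nat_le_iff)
  then have "w_dominating G w (\<lambda>v. real (f v))"
    by (simp add: w_dominating_def)
  then have "weighted_domination_number G w \<le> sum f (pverts G)"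
    unfolding weighted_domination_number_def by (intro Least_le) blast
  also have "\<dots> \<le> max_dispersed_weight G w"
    unfolding eq using I by (intro max_dispersed_weight_upper) (simp add: dispersed_iff)
  finally show "weighted_domination_number G w \<le> max_dispersed_weight G w" .
  show "max_dispersed_weight G w \<le> weighted_domination_number G w"
    using max_dispersed_weight_attained[of w] weighted_domination_number_attained[of w]
      dispersed_weight_le[of _ w]
    by metis
qed

end
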